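(* Assume the factor-intensity ranking and the change in the relative price of goods $$\theta_{T1}/\theta_{T2}>\theta_{L1}/\theta_{L2}>\theta_{K1}/\theta_{K2},\qquad \theta_{L1}>\theta_{L2},\qquad P=p_1^*-p_2^*>0.$$ The EWS-ratio vector $(S',U')$ exists on the EWS-ratio vector line segment, i.e. the line segment $AB$ joining the points $$A=\left(\frac{-W_{TL}}{W_{KL}},\ \frac{\theta_L}{\theta_K}\frac{-W_{LT}}{W_{KT}}\right),\qquad B=\left(\frac{a_{K0}'}{a_{T0}'}\theta_{KT},\ \frac{a_{K0}'}{a_{L0}'}\right).$$ Using this relationship, the position of the EWS-ratio vector can be estimated. For example, if $$X>Z>Y\ (\leftrightarrow\ w_T^*>w_L^*>w_K^* )\quad\text{and}\quad (a_{T0}',a_{K0}',a_{L0}')=(+,+,-)\ \text{in sign},$$ then the Cartesian coordinates of $A$ and of $B$ both have signs $(+,-)$. Hence both $A$ and $B$ are in quadrant IV, and $A$ is on the left-hand side of $B$. The line segment $AB$ exists in quadrant IV. Hence the EWS-ratio vector is in quadrant IV and satisfies $$0<\frac{-W_{TL}}{W_{KL}}<S'<\frac{a_{K0}'}{a_{T0}'}\theta_{KT},\qquad 0>\frac{\theta_L}{\theta_K}\frac{-W_{LT}}{W_{KT}}>U'>\frac{a_{K0}'}{a_{L0}'}.$$ In this case capital and land, the extreme factors, are economy-wide complements. Hence a strong Rybczynski result holds, that is, three of the Rybczynski sign patterns hold: the sign pattern of the matrix $[X_j^*/V_i^*]$ (rows $j=1,2$; columns $i=T,K,L$) is one of $$\begin{bmatrix}+&-&-\\-&+&+\end{bmatrix},\quad\begin{bmatrix}+&-&+\\-&+&+\end{bmatrix},\quad\begin{bmatrix}+&-&+\\-&+&-\end{bmatrix},$$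 according to the position of $(S',U')$ in quadrant IV.
   Context: Model: two goods $j=1,2$ and three factors $i\in\{T,K,L\}$ (land, capital, labor). Product and factor markets are perfectly competitive, factor supplies are perfectly inelastic, all factors are perfectly mobile between sectors and fully employed, and goods prices and factor endowments are exogenous. Production functions are homogeneous of degree one and strictly quasi-concave. $X_j$ is the output of good $j$, $V_i$ the supply of factor $i$, $p_j$ the price of good $j$, $w_i$ the reward of factor $i$, and $a_{ij}$ the cost-minimizing input of factor $i$ per unit of good $j$, a function of factor prices only, homogeneous of degree zero. Equilibrium conditions: $\sum_j a_{ij}X_j=V_i$ and $\sum_i a_{ij}w_i=p_j$. An asterisk denotes a rate of change ($x^*=dx/x$). Shares: $\theta_{ij}=a_{ij}w_i/p_j$ is the distributive share of factor $i$ in sector $j$; $\lambda_{ij}=a_{ij}X_j/V_i$; with total income $I=\sum_j p_jX_j=\sum_i w_iV_i$, $\theta_i=w_iV_i/I$ for a factor $i$; $\theta_{ih}=\theta_i/\theta_h$ for two factors $i\neq h$ (so $\theta_{KT}=\theta_K/\theta_T$). Under the assumed intensity ranking, land and capital are the extreme factors (sector 1 is relatively land intensive, sector 2 relatively capital intensive) and labor is the middle factor. Differentiated system: $\sum_i\theta_{ij}w_i^*=p_j^*$; $\sum_i\theta_{ij}a_{ij}^*=0$; $a_{ij}^*=\sum_h\varepsilon^{ij}_hw_h^*$ with $\varepsilon^{ij}_h=\partial\log a_{ij}/\partial\log w_h=\theta_{hj}\sigma^{ij}_h$, where the Allen partial elasticities of substitution $\sigma^{ij}_h$ satisfy $\sigma^{ij}_h=\sigma^{hj}_i$,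 $\sigma^{ij}_i<0$, $\sum_h\theta_{hj}\sigma^{ij}_h=0$; and $\sum_h g_{ih}w_h^*+\sum_j\lambda_{ij}X_j^*=V_i^*$, where $g_{ih}=\sum_j\lambda_{ij}\varepsilon^{ij}_h$ is the economy-wide substitution (EWS) between factors $i$ and $h$. The $g_{ih}$ satisfy $\sum_hg_{ih}=0$, $g_{ih}=(\theta_h/\theta_i)g_{hi}$, $g_{ii}<0$ and $g_{KK}g_{TT}-g_{TK}g_{KT}>0$. Factors $i\neq h$ are economy-wide complements if $g_{ih}<0$. The EWS-ratio vector is $(S',U')=(g_{LK}/g_{LT},\ g_{KT}/g_{LT})$. Quadrants refer to the plane with horizontal axis $S'$ and vertical axis $U'$; quadrant IV is $S'>0>U'$. Other notation: $W_{ih}=w_i^*-w_h^*$; $a_{i0}'=\sum_j\lambda_{ij}a_{ij}^*$ (the aggregate of the rates of change of the input-output coefficients of factor $i$); $(X,Y,Z)=(w_T^*-p_1^*,\ w_K^*-p_1^*,\ w_L^*-p_1^* )$. The points $A$ and $B$ are the intersections of the straight line $U'=-\frac{a_{T0}'\theta_TW_{LK}}{a_{L0}'\theta_KW_{KT}}S'+\frac{a_{K0}'W_{LT}}{a_{L0}'W_{KT}}$, on which $(S',U')$ lies, with the hyperbola $U'=-\frac{\theta_L}{\theta_K}\frac{S'}{S'+1}$. $X_j^*/V_i^*$ denotes the proportional response of output $X_j$ to a change in the endowment $V_i$; its sign matrix is the Rybczynski sign pattern. A strong Rybczynski result means that an increase in the supply of an extreme factor raises the output of the good that is relatively intensive in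 it and reduces the output of the other good: $X_1^*/V_T^*>0$, $X_2^*/V_T^*<0$, $X_1^*/V_K^*<0$, $X_2^*/V_K^*>0$.
   Formalization: The vector is not always on segment AB: it is shown to lie on line AB, and on the segment exactly when A and B are on the same branch of the hyperbola (quotients defined). The "one of three sign patterns" claim excludes zero labor responses, where no +/- pattern applies. *)

theory Defs
  imports "HOL-Analysis.Analysis"
begin

datatype factor = Land | Capital | Labor
datatype good = Good1 | Good2

lemma UNIV_factor: "UNIV = {Land, Capital, Labor}"
  using factor.exhaust by auto

lemma UNIV_good: "UNIV = {Good1, Good2}"
  using good.exhaust by auto

instance factor :: finite
  by standard (simp add: UNIV_factor)

instance good :: finite
  by standard (simp add: UNIV_good)

definition pos_vec :: "real ^ factor \<Rightarrow> bool" where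
  "pos_vec x \<longleftrightarrow> (\<forall>i. 0 < x $ i)"


section \<open>The economy in levels\<close>

text \<open>\<open>unit_input E j w\<close> is the vector of inputs per unit of good \<open>j\<close> at factor prices \<open>w\<close>;
  the remaining real components are the equilibrium values at which everything is evaluated.\<close>

record economy =
  prod_fn :: "good \<Rightarrow> real ^ factor \<Rightarrow> real"
  unit_input :: "good \<Rightarrow> real ^ factor \<Rightarrow> real ^ factor"
  reward :: "real ^ factor"
  output_level :: "good \<Rightarrow> real"
  price :: "good \<Rightarrow> real"
  endowment :: "real ^ factor"

definition homogeneous_deg1 :: "(real ^ factor \<Rightarrow> real) \<Rightarrow> bool" where
  "homogeneous_deg1 f \<longleftrightarrow> (\<forall>x c. pos_vec x \<and> 0 < c \<longrightarrow> f (c *\<^sub>R x) = c * f x)"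

text \<open>Strictness is required only between strictly positive input vectors: functions such as
  Cobb-Douglas are constant on the boundary of the orthant.\<close>

definition strictly_quasi_concave :: "(real ^ factor \<Rightarrow> real) \<Rightarrow> bool" where
  "strictly_quasi_concave f \<longleftrightarrow>
     (\<forall>x y t. pos_vec x \<and> pos_vec y \<and> x \<noteq> y \<and> 0 < t \<and> t < 1 \<longrightarrow>
        min (f x) (f y) < f ((1 - t) *\<^sub>R x + t *\<^sub>R y))"

definition cost_minimizing :: "(real ^ factor \<Rightarrow> real) \<Rightarrow> real ^ factor \<Rightarrow> real ^ factor \<Rightarrow> bool" where
  "cost_minimizing f w x \<longleftrightarrow>
     pos_vec x \<and> f x = 1 \<and> (\<forall>y. pos_vec y \<and> 1 \<le> f y \<longrightarrow> w \<bullet> x \<le> w \<bullet> y)"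

definition input_coeff :: "economy \<Rightarrow> factor \<Rightarrow> good \<Rightarrow> real" where
  "input_coeff E i j = unit_input E j (reward E) $ i"

definition technology :: "economy \<Rightarrow> bool" where
  "technology E \<longleftrightarrow>
     (\<forall>j. homogeneous_deg1 (prod_fn E j) \<and> strictly_quasi_concave (prod_fn E j)) \<and>
     (\<forall>j w. pos_vec w \<longrightarrow> cost_minimizing (prod_fn E j) w (unit_input E j w)) \<and>
     (\<forall>j. unit_input E j differentiable (at (reward E)))"

definition equilibrium :: "economy \<Rightarrow> bool" where
  "equilibrium E \<longleftrightarrow>
     pos_vec (reward E) \<and> pos_vec (endowment E) \<and> (\<forall>j. 0 < output_level E j \<and> 0 < price E j) \<and>
     (\<forall>i. (\<Sum>j\<in>UNIV. input_coeff E i j * output_level E j) = endowment E $ i) \<and>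
     (\<forall>j. (\<Sum>i\<in>UNIV. input_coeff E i j * reward E $ i) = price E j)"


section \<open>Shares and substitution terms\<close>

definition dist_share :: "economy \<Rightarrow> factor \<Rightarrow> good \<Rightarrow> real" where
  "dist_share E i j = input_coeff E i j * reward E $ i / price E j"

definition alloc_share :: "economy \<Rightarrow> factor \<Rightarrow> good \<Rightarrow> real" where
  "alloc_share E i j = input_coeff E i j * output_level E j / endowment E $ i"

definition income :: "economy \<Rightarrow> real" where
  "income E = (\<Sum>j\<in>UNIV. price E j * output_level E j)"

definition income_share :: "economy \<Rightarrow> factor \<Rightarrow> real" where
  "income_share E i = reward E $ i * endowment E $ i / income E"

text \<open>\<open>elasticity E i j h\<close> is the partial derivative of \<open>log a\<^sub>i\<^sub>j\<close> with respect to \<open>log w\<^sub>h\<close>.\<close>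

definition elasticity :: "economy \<Rightarrow> factor \<Rightarrow> good \<Rightarrow> factor \<Rightarrow> real" where
  "elasticity E i j h =
     reward E $ h / input_coeff E i j *
     (frechet_derivative (unit_input E j) (at (reward E)) (axis h 1) $ i)"

definition allen :: "economy \<Rightarrow> factor \<Rightarrow> good \<Rightarrow> factor \<Rightarrow> real" where
  "allen E i j h = elasticity E i j h / dist_share E h j"

definition ews :: "economy \<Rightarrow> factor \<Rightarrow> factor \<Rightarrow> real" where
  "ews E i h = (\<Sum>j\<in>UNIV. alloc_share E i j * elasticity E i j h)"

text \<open>The remaining standard properties of the \<open>ews\<close> terms (zero row sums, symmetry up to income
  shares, negative own terms) follow from those of the Allen elasticities; the determinant
  condition does not.\<close>

definition substitution_properties :: "economy \<Rightarrow> bool" where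
  "substitution_properties E \<longleftrightarrow>
     (\<forall>i j h. allen E i j h = allen E h j i) \<and>
     (\<forall>i j. allen E i j i < 0) \<and>
     (\<forall>i j. (\<Sum>h\<in>UNIV. dist_share E h j * allen E i j h) = 0) \<and>
     ews E Capital Capital * ews E Land Land - ews E Land Capital * ews E Capital Land > 0"

definition ews_complements :: "economy \<Rightarrow> factor \<Rightarrow> factor \<Rightarrow> bool" where
  "ews_complements E i h \<longleftrightarrow> i \<noteq> h \<and> ews E i h < 0"

text \<open>The vector \<open>(S', U')\<close>; it is meaningful only if \<open>ews E Labor Land \<noteq> 0\<close>.\<close>

definition ews_ratio_vector :: "economy \<Rightarrow> real \<times> real" where
  "ews_ratio_vector E =
     (ews E Labor Capital / ews E Labor Land, ews E Capital Land / ews E Labor Land)"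


section \<open>Rates of change\<close>

text \<open>The components are the relative changes \<open>dx / x\<close> of factor rewards, outputs, goods prices
  and factor supplies.\<close>

record rates =
  reward_rate :: "factor \<Rightarrow> real"
  output_rate :: "good \<Rightarrow> real"
  price_rate :: "good \<Rightarrow> real"
  supply_rate :: "factor \<Rightarrow> real"

definition coeff_rate :: "economy \<Rightarrow> rates \<Rightarrow> factor \<Rightarrow> good \<Rightarrow> real" where
  "coeff_rate E c i j = (\<Sum>h\<in>UNIV. elasticity E i j h * reward_rate c h)"

definition differentiated_system :: "economy \<Rightarrow> rates \<Rightarrow> bool" where
  "differentiated_system E c \<longleftrightarrow>
     (\<forall>j. (\<Sum>i\<in>UNIV. dist_share E i j * reward_rate c i) = price_rate c j) \<and>
     (\<forall>j. (\<Sum>i\<in>UNIV. dist_share E i j * coeff_rate E c i j) = 0) \<and>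
     (\<forall>i. (\<Sum>h\<in>UNIV. ews E i h * reward_rate c h)
           + (\<Sum>j\<in>UNIV. alloc_share E i j * output_rate c j) = supply_rate c i)"

definition reward_gap :: "rates \<Rightarrow> factor \<Rightarrow> factor \<Rightarrow> real" where
  "reward_gap c i h = reward_rate c i - reward_rate c h"

text \<open>The real factor price changes \<open>X, Y, Z\<close> are this for land, capital and labor.\<close>

definition reward_rate_rel :: "rates \<Rightarrow> factor \<Rightarrow> real" where
  "reward_rate_rel c i = reward_rate c i - price_rate c Good1"

definition agg_coeff_rate :: "economy \<Rightarrow> rates \<Rightarrow> factor \<Rightarrow> real" where
  "agg_coeff_rate E c i = (\<Sum>j\<in>UNIV. alloc_share E i j * coeff_rate E c i j)"


section \<open>Geometry of the plane of EWS-ratios\<close>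

definition quadrant_IV :: "(real \<times> real) set" where
  "quadrant_IV = {(s, u). 0 < s \<and> u < 0}"

definition ews_line :: "economy \<Rightarrow> rates \<Rightarrow> (real \<times> real) set" where
  "ews_line E c = {(s, u). u =
     - (agg_coeff_rate E c Land * income_share E Land * reward_gap c Labor Capital)
       / (agg_coeff_rate E c Labor * income_share E Capital * reward_gap c Capital Land) * s
     + (agg_coeff_rate E c Capital * reward_gap c Labor Land)
       / (agg_coeff_rate E c Labor * reward_gap c Capital Land)}"

definition ews_hyperbola :: "economy \<Rightarrow> (real \<times> real) set" where
  "ews_hyperbola E = {(s, u). s \<noteq> -1 \<and>
     u = - (income_share E Labor / income_share E Capital) * (s / (s + 1))}"

text \<open>The two branches of the hyperbola are separated by its asymptote \<open>s = -1\<close>.\<close>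

definition same_branch :: "real \<times> real \<Rightarrow> real \<times> real \<Rightarrow> bool" where
  "same_branch P Q \<longleftrightarrow> (fst P > -1 \<and> fst Q > -1) \<or> (fst P < -1 \<and> fst Q < -1)"

definition point_A :: "economy \<Rightarrow> rates \<Rightarrow> real \<times> real" where
  "point_A E c =
     (- reward_gap c Land Labor / reward_gap c Capital Labor,
      income_share E Labor / income_share E Capital
        * (- reward_gap c Labor Land / reward_gap c Capital Land))"

definition point_B :: "economy \<Rightarrow> rates \<Rightarrow> real \<times> real" where
  "point_B E c =
     (agg_coeff_rate E c Capital / agg_coeff_rate E c Land
        * (income_share E Capital / income_share E Land),
      agg_coeff_rate E c Capital / agg_coeff_rate E c Labor)"


section \<open>Rybczynski responses\<close>

text \<open>The response \<open>X\<^sub>j\<^sup>* / V\<^sub>i\<^sup>*\<close> when the supply of factor \<open>i\<close> alone changes, at constant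
  goods prices. The description denotes only if the differentiated system determines it.\<close>

definition rybczynski :: "economy \<Rightarrow> good \<Rightarrow> factor \<Rightarrow> real" where
  "rybczynski E j i = (THE r. \<exists>c. differentiated_system E c \<and>
     (\<forall>k. price_rate c k = 0) \<and> (\<forall>h. h \<noteq> i \<longrightarrow> supply_rate c h = 0) \<and>
     supply_rate c i \<noteq> 0 \<and> r = output_rate c j / supply_rate c i)"

definition rybczynski_signs :: "economy \<Rightarrow> real list list" where
  "rybczynski_signs E =
     map (\<lambda>j. map (\<lambda>i. sgn (rybczynski E j i)) [Land, Capital, Labor]) [Good1, Good2]"

definition strong_rybczynski :: "economy \<Rightarrow> bool" where
  "strong_rybczynski E \<longleftrightarrow>
     rybczynski E Good1 Land > 0 \<and> rybczynski E Good2 Land < 0 \<and>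
     rybczynski E Good1 Capital < 0 \<and> rybczynski E Good2 Capital > 0"

text \<open>Solving the differentiated system for a change in the supply of labor alone shows that,
  where \<open>ews E Labor Land > 0\<close>, the response of \<open>Good1\<close> has the sign of \<open>labor_border E Good2\<close> and
  the response of \<open>Good2\<close> the opposite sign of \<open>labor_border E Good1\<close> at the EWS-ratio vector. The
  zero sets of these two affine functions divide quadrant IV into the regions with different
  sign patterns.\<close>

definition labor_border :: "economy \<Rightarrow> good \<Rightarrow> real \<times> real \<Rightarrow> real" where
  "labor_border E j = (\<lambda>(s, u).
     income_share E Capital * (dist_share E Labor Good1 - dist_share E Labor Good2)
       * (dist_share E Capital j + dist_share E Land j) * u
     - income_share E Labor * (dist_share E Land Good1 - dist_share E Land Good2)
       * dist_share E Land j * s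
     + income_share E Labor * (dist_share E Capital Good2 - dist_share E Capital Good1)
       * dist_share E Capital j)"

end

(* Weighting each EWS term by an income share makes the substitution matrix symmetric with zero row
   sums, so only its three off-diagonal entries matter, and the determinant condition makes it
   negative definite modulo common reward changes. In the (S', U')-plane that condition says that
   the EWS-ratio vector lies above the hyperbola in the sense r S' + (1 + S') U' > 0; along the line
   through A and B the left-hand side is a quadratic with roots at A and B, and the sign of its
   leading coefficient, the slope of the line, is decided by whether A and B share a branch.
   Definiteness applied to the reward changes puts A to the left of B.

   For the Rybczynski responses, the reward changes at fixed goods prices are orthogonal to both
   share vectors, hence multiples of their cross product, whose pairwise differences are, up to
   sign, the share differences. This yields closed formulas whose denominator is the
   substitution form evaluated at the share differences. *)

theory Submission
  imports Defs
begin

section \<open>A line meeting a hyperbola\<close>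

text \<open>An affine map commutes with convex combinations, so on a non-vertical line betweenness
  can be read off from the abscissae.\<close>

lemma graph_mem_closed_segment_iff:
  fixes m n s x y :: real
  shows "(s, m * s + n) \<in> closed_segment (x, m * x + n) (y, m * y + n) \<longleftrightarrow> s \<in> closed_segment x y"
proof -
  have *: "m * ((1 - u) * x + u * y) + n = (1 - u) * (m * x + n) + u * (m * y + n)" for u
    by (simp add: algebra_simps)
  then show ?thesis
    by (auto simp: in_segment)
qed

lemma mem_closed_segment_real_iff:
  fixes s x y :: real
  shows "s \<in> closed_segment x y \<longleftrightarrow> (s - x) * (s - y) \<le> 0"
  by (auto simp: closed_segment_eq_real_ivl mult_le_0_iff)

text \<open>The second and third assumptions are Vieta's formulas for the abscissae \<open>x\<close>, \<open>y\<close> of the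
  intersections of \<open>u = m s + n\<close> with \<open>u = - r s / (s + 1)\<close>, that is, the roots of
  \<open>r s + (1 + s) (m s + n)\<close>.\<close>

locale line_meets_hyperbola =
  fixes m n r x y :: real
  assumes r_pos: "0 < r"
    and prod_roots: "n = m * (x * y)"
    and prod_roots_shifted: "m * ((1 + x) * (1 + y)) = - r"
begin

text \<open>Both sides are polynomials in \<open>s\<close> with leading term \<open>m * s^2\<close>;
  the two root hypotheses say that they agree at \<open>s = 0\<close> and at
  \<open>s = -1\<close>.\<close>

lemma quadratic_factor: "r * s + (1 + s) * (m * s + n) = m * ((s - x) * (s - y))"
proof -
  have r: "r = - (m * ((1 + x) * (1 + y)))"
    using prod_roots_shifted by linarith
  show ?thesis
    unfolding r prod_roots by (simp add: algebra_simps)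
qed

lemma slope_nonzero: "m \<noteq> 0" and x_neq: "x \<noteq> -1" and y_neq: "y \<noteq> -1"
  using prod_roots_shifted r_pos by auto

lemma intersection:
  "{(s, u). u = m * s + n} \<inter> {(s, u). s \<noteq> -1 \<and> u = - r * (s / (s + 1))}
     = {(x, m * x + n), (y, m * y + n)}"
proof -
  have "m * s + n = - r * (s / (s + 1)) \<longleftrightarrow> s = x \<or> s = y" if "s \<noteq> -1" for s
  proof -
    have "s + 1 \<noteq> 0"
      using that by auto
    then have "m * s + n = - r * (s / (s + 1)) \<longleftrightarrow> r * s + (1 + s) * (m * s + n) = 0"
      by (simp add: field_simps) argo
    then show ?thesis
      unfolding quadratic_factor using slope_nonzero by auto
  qed
  then show ?thesis
    using x_neq y_neq by auto
qed

text \<open>Since \<open>m * ((1 + x) * (1 + y))\<close> is negative, \<open>m < 0\<close> holds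
  exactly when \<open>1 + x\<close> and \<open>1 + y\<close> have equal signs.\<close>

lemma same_branch_iff: "same_branch (x, u) (y, v) \<longleftrightarrow> m < 0"
proof -
  have "m < 0 \<longleftrightarrow> 0 < (1 + x) * (1 + y)"
    using prod_roots_shifted r_pos by (smt (verit) mult_less_0_iff)
  then show ?thesis
    by (auto simp: same_branch_def zero_less_mult_iff)
qed

lemma segment_iff:
  assumes "0 < r * s + (1 + s) * (m * s + n)"
  shows "(s, m * s + n) \<in> closed_segment (x, m * x + n) (y, m * y + n) \<longleftrightarrow> m < 0"
proof -
  have "(s - x) * (s - y) \<le> 0 \<longleftrightarrow> m < 0" if "0 < m * ((s - x) * (s - y))"
    using that by (metis less_le_not_le linorder_neqE_linordered_idom mult_neg_pos mult_pos_pos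
        mult_zero_left not_le zero_less_mult_iff)
  then show ?thesis
    using assms
    unfolding quadratic_factor graph_mem_closed_segment_iff mem_closed_segment_real_iff .
qed

end


section \<open>Symmetrized economy-wide substitution\<close>

lemma sum_factor: "(\<Sum>i\<in>UNIV. f i) = f Land + f Capital + (f Labor :: real)"
  by (simp add: UNIV_factor)

lemma sum_good: "(\<Sum>j\<in>UNIV. f j) = f Good1 + (f Good2 :: real)"
  by (simp add: UNIV_good)

definition good_share :: "economy \<Rightarrow> good \<Rightarrow> real" where
  "good_share E j = price E j * output_level E j / income E"

definition sym_ews :: "economy \<Rightarrow> factor \<Rightarrow> factor \<Rightarrow> real" where
  "sym_ews E i h = income_share E i * ews E i h"

text \<open>The substitution term between the two factors other than the given one. In these terms the
  quadratic form of the substitution matrix is the sum of \<open>opposite_ews\<close> times squared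
  differences.\<close>

fun opposite_ews :: "economy \<Rightarrow> factor \<Rightarrow> real" where
  "opposite_ews E Land = sym_ews E Labor Capital"
| "opposite_ews E Capital = sym_ews E Labor Land"
| "opposite_ews E Labor = sym_ews E Capital Land"

definition share_gap :: "economy \<Rightarrow> factor \<Rightarrow> real" where
  "share_gap E i = dist_share E i Good1 - dist_share E i Good2"

text \<open>This is minus the quadratic form of \<open>sym_ews\<close> at
  \<open>share_cross\<close>, whose pairwise differences are the share gaps up to sign. It serves as
  the determinant of the differentiated system at fixed goods prices.\<close>

definition response_det :: "economy \<Rightarrow> real" where
  "response_det E = (\<Sum>i\<in>UNIV. opposite_ews E i * (share_gap E i)\<^sup>2)"

text \<open>The vector with entries \<open>opposite_ews E i * share_gap E i\<close>, centered at its
  mean under the shares of the other good (negated for \<open>Good2\<close>). As shares sum to one,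
  centering makes it orthogonal to these shares.\<close>

fun response_num :: "economy \<Rightarrow> good \<Rightarrow> factor \<Rightarrow> real" where
  "response_num E Good1 i = opposite_ews E i * share_gap E i
     - (\<Sum>h\<in>UNIV. opposite_ews E h * share_gap E h * dist_share E h Good2)"
| "response_num E Good2 i = (\<Sum>h\<in>UNIV. opposite_ews E h * share_gap E h * dist_share E h Good1)
     - opposite_ews E i * share_gap E i"

section \<open>Positivity, adding-up and symmetry of shares and substitution terms\<close>

locale economy_equilibrium =
  fixes E :: economy
  assumes technology: "technology E"
    and equilibrium: "equilibrium E"
    and substitution: "substitution_properties E"
begin

lemma input_coeff_pos: "0 < input_coeff E i j"
  using technology equilibrium
  unfolding technology_def equilibrium_def cost_minimizing_def pos_vec_def input_coeff_def by blast

lemma reward_pos: "0 < reward E $ i" and endowment_pos: "0 < endowment E $ i"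
  and output_pos: "0 < output_level E j" and price_pos: "0 < price E j"
  and zero_profit: "(\<Sum>i\<in>UNIV. input_coeff E i j * reward E $ i) = price E j"
  using equilibrium unfolding equilibrium_def pos_vec_def by auto

lemma income_pos: "0 < income E"
  unfolding income_def sum_good using price_pos output_pos by (simp add: add_pos_pos)

lemma dist_share_pos: "0 < dist_share E i j"
  unfolding dist_share_def using input_coeff_pos reward_pos price_pos by simp

lemma income_share_pos: "0 < income_share E i"
  unfolding income_share_def using reward_pos endowment_pos income_pos by simp

lemma good_share_pos: "0 < good_share E j"
  unfolding good_share_def using price_pos output_pos income_pos by simp

lemma sum_dist_share: "(\<Sum>i\<in>UNIV. dist_share E i j) = 1"
proof -
  have "(\<Sum>i\<in>UNIV. dist_share E i j) = (\<Sum>i\<in>UNIV. input_coeff E i j * reward E $ i) / price E j"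
    unfolding dist_share_def by (simp add: sum_divide_distrib)
  also have "\<dots> = 1"
    using price_pos[of j] unfolding zero_profit by simp
  finally show ?thesis .
qed

text \<open>This is why weighting by income shares symmetrizes: \<open>dist_share E i j\<close>
  appears next to the \<open>dist_share E h j\<close> already contained in the elasticity.\<close>

lemma income_share_alloc_share:
  "income_share E i * alloc_share E i j = good_share E j * dist_share E i j"
  unfolding income_share_def alloc_share_def good_share_def dist_share_def
  using endowment_pos[of i] price_pos[of j] by (simp add: field_simps)

lemma elasticity_allen: "elasticity E i j h = dist_share E h j * allen E i j h"
  unfolding allen_def using dist_share_pos[of h j] by simp

lemma allen_sym: "allen E i j h = allen E h j i"
  using substitution unfolding substitution_properties_def by blast

lemma sum_elasticity: "(\<Sum>h\<in>UNIV. elasticity E i j h) = 0"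
  using substitution unfolding substitution_properties_def elasticity_allen by blast

text \<open>Symmetry of the Allen terms turns this column sum into a row sum of elasticities.
  Consequently the cost-minimization block of the differentiated system holds automatically.\<close>

lemma sum_dist_share_elasticity: "(\<Sum>i\<in>UNIV. dist_share E i j * elasticity E i j h) = 0"
proof -
  have "(\<Sum>i\<in>UNIV. dist_share E i j * elasticity E i j h)
      = dist_share E h j * (\<Sum>i\<in>UNIV. elasticity E h j i)"
    unfolding elasticity_allen allen_sym[of _ j h] sum_distrib_left by (simp add: algebra_simps)
  then show ?thesis
    by (simp add: sum_elasticity)
qed

lemma sum_dist_share_coeff_rate: "(\<Sum>i\<in>UNIV. dist_share E i j * coeff_rate E c i j) = 0"
proof -
  have "(\<Sum>i\<in>UNIV. dist_share E i j * coeff_rate E c i j)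
      = (\<Sum>h\<in>UNIV. (\<Sum>i\<in>UNIV. dist_share E i j * elasticity E i j h) * reward_rate c h)"
    unfolding coeff_rate_def sum_factor by (simp add: algebra_simps)
  then show ?thesis
    by (simp add: sum_dist_share_elasticity)
qed

lemma sym_ews_expand:
  "sym_ews E i h = (\<Sum>j\<in>UNIV. good_share E j * dist_share E i j * dist_share E h j * allen E i j h)"
proof -
  have "sym_ews E i h
      = (\<Sum>j\<in>UNIV. (income_share E i * alloc_share E i j) * dist_share E h j * allen E i j h)"
    unfolding sym_ews_def ews_def elasticity_allen sum_distrib_left by (simp add: algebra_simps)
  then show ?thesis
    by (simp add: income_share_alloc_share)
qed

lemma sym_ews_commute: "sym_ews E i h = sym_ews E h i"
  unfolding sym_ews_expand using allen_sym[of i _ h] by (simp add: algebra_simps)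

lemma sum_ews: "(\<Sum>h\<in>UNIV. ews E i h) = 0"
proof -
  have "(\<Sum>h\<in>UNIV. ews E i h) = (\<Sum>j\<in>UNIV. alloc_share E i j * (\<Sum>h\<in>UNIV. elasticity E i j h))"
    unfolding ews_def sum_factor sum_good by (simp add: algebra_simps)
  then show ?thesis
    by (simp add: sum_elasticity)
qed

lemma sum_sym_ews: "(\<Sum>h\<in>UNIV. sym_ews E i h) = 0"
  unfolding sym_ews_def sum_distrib_left[symmetric] by (simp add: sum_ews)

lemma sym_ews_own_neg: "sym_ews E i i < 0"
proof -
  have "allen E i j i < 0" for j
    using substitution unfolding substitution_properties_def by blast
  then have "good_share E j * dist_share E i j * dist_share E i j * allen E i j i < 0" for j
    using good_share_pos[of j] dist_share_pos[of i j] by (simp add: mult_pos_neg)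
  then show ?thesis
    unfolding sym_ews_expand sum_good by (simp add: add_neg_neg)
qed

lemma sym_ews_Land_Land: "sym_ews E Land Land = - opposite_ews E Capital - opposite_ews E Labor"
  and sym_ews_Capital_Capital: "sym_ews E Capital Capital = - opposite_ews E Land - opposite_ews E Labor"
  and sym_ews_Labor_Labor: "sym_ews E Labor Labor = - opposite_ews E Land - opposite_ews E Capital"
  using sum_sym_ews[of Land] sum_sym_ews[of Capital] sum_sym_ews[of Labor]
  by (simp_all add: sum_factor sym_ews_commute[of Land Capital] sym_ews_commute[of Land Labor]
      sym_ews_commute[of Capital Labor])

lemmas sym_ews_opposite = sym_ews_Land_Land sym_ews_Capital_Capital sym_ews_Labor_Labor
  opposite_ews.simps[symmetric] sym_ews_commute[of Land Capital] sym_ews_commute[of Land Labor]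
  sym_ews_commute[of Capital Labor]

text \<open>By the zero row sums, these are the diagonal entries of \<open>sym_ews\<close> with the
  sign reversed.\<close>

lemma opposite_ews_sum_pos:
  "0 < opposite_ews E Land + opposite_ews E Capital"
  "0 < opposite_ews E Land + opposite_ews E Labor"
  "0 < opposite_ews E Capital + opposite_ews E Labor"
  using sym_ews_own_neg[of Land] sym_ews_own_neg[of Capital] sym_ews_own_neg[of Labor]
  by (simp_all only: sym_ews_opposite)

text \<open>The determinant condition, scaled by two income shares, is a principal minor of
  \<open>sym_ews\<close>; written in off-diagonal entries it is their second elementary symmetric
  polynomial.\<close>

lemma opposite_ews_det_pos:
  "0 < opposite_ews E Land * opposite_ews E Capital + opposite_ews E Land * opposite_ews E Labor
     + opposite_ews E Capital * opposite_ews E Labor"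
proof -
  have "0 < ews E Capital Capital * ews E Land Land - ews E Land Capital * ews E Capital Land"
    using substitution unfolding substitution_properties_def by blast
  then have "0 < (income_share E Capital * income_share E Land) *
      (ews E Capital Capital * ews E Land Land - ews E Land Capital * ews E Capital Land)"
    using income_share_pos by simp
  also have "\<dots> = sym_ews E Capital Capital * sym_ews E Land Land
      - sym_ews E Land Capital * sym_ews E Capital Land"
    unfolding sym_ews_def by (simp add: algebra_simps)
  finally show ?thesis
    unfolding sym_ews_opposite by (simp add: algebra_simps)
qed

text \<open>Here \<open>x\<close>, \<open>y\<close> and \<open>x + y\<close> play the role of the
  three pairwise differences. Multiplying the form by the positive \<open>a + d\<close> completes
  the square and leaves the minor times \<open>y^2\<close>.\<close>

lemma opposite_ews_quadratic_form_pos: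
  assumes "x \<noteq> 0" and "y \<noteq> 0"
  shows "0 < opposite_ews E Capital * x\<^sup>2 + opposite_ews E Land * y\<^sup>2 + opposite_ews E Labor * (x + y)\<^sup>2"
proof -
  define a where "a = opposite_ews E Capital"
  define b where "b = opposite_ews E Land"
  define d where "d = opposite_ews E Labor"
  have "0 < a + d"
    using opposite_ews_sum_pos(3) by (simp add: a_def d_def)
  have "0 < a * b + a * d + b * d"
    using opposite_ews_det_pos by (simp add: a_def b_def d_def algebra_simps)
  then have "0 < (a * b + a * d + b * d) * y\<^sup>2"
    using assms by simp
  also have "\<dots> \<le> ((a + d) * x + d * y)\<^sup>2 + (a * b + a * d + b * d) * y\<^sup>2"
    by simp
  also have "\<dots> = (a + d) * (a * x\<^sup>2 + b * y\<^sup>2 + d * (x + y)\<^sup>2)"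
    by (simp add: algebra_simps power2_eq_square)
  finally show ?thesis
    using \<open>0 < a + d\<close> by (simp add: zero_less_mult_iff a_def b_def d_def)
qed

section \<open>Aggregate input responses and the EWS-ratio vector in off-diagonal terms\<close>

lemma income_share_agg_coeff_rate:
  "income_share E i * agg_coeff_rate E c i = (\<Sum>h\<in>UNIV. sym_ews E i h * reward_rate c h)"
  unfolding agg_coeff_rate_def coeff_rate_def sym_ews_def ews_def sum_factor sum_good
  by (simp add: algebra_simps)

lemma agg_coeff_rate_gaps:
  "income_share E Land * agg_coeff_rate E c Land
     = opposite_ews E Capital * reward_gap c Labor Land + opposite_ews E Labor * reward_gap c Capital Land"
  "income_share E Capital * agg_coeff_rate E c Capital
     = opposite_ews E Labor * reward_gap c Land Capital + opposite_ews E Land * reward_gap c Labor Capital"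
  "income_share E Labor * agg_coeff_rate E c Labor
     = opposite_ews E Capital * reward_gap c Land Labor + opposite_ews E Land * reward_gap c Capital Labor"
  unfolding income_share_agg_coeff_rate sum_factor sym_ews_opposite reward_gap_def
  by (simp_all add: algebra_simps)

lemma ews_ratio_vector_opposite:
  "ews_ratio_vector E = (opposite_ews E Land / opposite_ews E Capital,
     income_share E Labor / income_share E Capital * (opposite_ews E Labor / opposite_ews E Capital))"
  unfolding ews_ratio_vector_def opposite_ews.simps sym_ews_def
  using income_share_pos[of Labor] income_share_pos[of Capital] by (simp add: field_simps)

lemma ews_ratio_vector_above_hyperbola:
  assumes "ews E Labor Land \<noteq> 0" and "ews_ratio_vector E = (s, u)"
  shows "0 < income_share E Labor / income_share E Capital * s + (1 + s) * u"
proof -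
  define a where "a = opposite_ews E Capital"
  define b where "b = opposite_ews E Land"
  define d where "d = opposite_ews E Labor"
  define r where "r = income_share E Labor / income_share E Capital"
  have a0: "a \<noteq> 0"
    using assms(1) income_share_pos[of Labor] by (simp add: a_def sym_ews_def)
  have su: "s = b / a" "u = r * (d / a)"
    using assms(2) unfolding ews_ratio_vector_opposite a_def b_def d_def r_def by simp_all
  have "r * s + (1 + s) * u = r * ((a * b + a * d + b * d) / a\<^sup>2)"
    unfolding su using a0 by (simp add: field_simps power2_eq_square)
  moreover have "0 < r"
    using income_share_pos by (simp add: r_def)
  moreover have "0 < a * b + a * d + b * d"
    using opposite_ews_det_pos by (simp add: a_def b_def d_def algebra_simps)
  ultimately show ?thesis
    using a0 unfolding r_def[symmetric] by simp
qed


section \<open>The EWS-ratio line segment\<close>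

lemma sum_income_share_agg_coeff_rate:
  "income_share E Land * agg_coeff_rate E c Land + income_share E Capital * agg_coeff_rate E c Capital
     + income_share E Labor * agg_coeff_rate E c Labor = 0"
  unfolding agg_coeff_rate_gaps reward_gap_def by (simp add: algebra_simps)

definition ews_slope :: "rates \<Rightarrow> real" where
  "ews_slope c = - (agg_coeff_rate E c Land * income_share E Land * reward_gap c Labor Capital)
       / (agg_coeff_rate E c Labor * income_share E Capital * reward_gap c Capital Land)"

definition ews_intercept :: "rates \<Rightarrow> real" where
  "ews_intercept c = (agg_coeff_rate E c Capital * reward_gap c Labor Land)
       / (agg_coeff_rate E c Labor * reward_gap c Capital Land)"

lemma ews_line_eq: "ews_line E c = {(s, u). u = ews_slope c * s + ews_intercept c}"
  unfolding ews_line_def ews_slope_def ews_intercept_def by simp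

context
  fixes c :: rates
  assumes gap_KL: "reward_gap c Capital Labor \<noteq> 0"
    and gap_KT: "reward_gap c Capital Land \<noteq> 0"
    and agg_T: "agg_coeff_rate E c Land \<noteq> 0"
    and agg_L: "agg_coeff_rate E c Labor \<noteq> 0"
begin

lemma point_A_on_line: "point_A E c \<in> ews_line E c"
proof -
  have L: "reward_gap c Land Labor = - reward_gap c Labor Land"
    "reward_gap c Labor Capital = - reward_gap c Capital Labor"
    by (simp_all add: reward_gap_def)
  \<comment> \<open>Only land and labor aggregates occur in the slope and in point A after this
    elimination, so the equation of the line becomes a rational identity.\<close>
  have K: "agg_coeff_rate E c Capital = - (income_share E Land * agg_coeff_rate E c Land
      + income_share E Labor * agg_coeff_rate E c Labor) / income_share E Capital"
    using sum_income_share_agg_coeff_rate[of c] income_share_pos[of Capital]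
    by (simp add: eq_divide_eq) argo
  show ?thesis
    unfolding point_A_def ews_line_def L K
    using gap_KL gap_KT agg_L income_share_pos[of Capital]
    by (simp add: divide_simps) (simp add: algebra_simps)
qed

lemma point_B_on_line: "point_B E c \<in> ews_line E c"
proof -
  have "reward_gap c Labor Land = reward_gap c Labor Capital + reward_gap c Capital Land"
    by (simp add: reward_gap_def)
  then show ?thesis
    unfolding point_B_def ews_line_def
    using gap_KT agg_T agg_L income_share_pos[of Capital] income_share_pos[of Land]
    by (simp add: divide_simps) (simp add: algebra_simps)
qed

lemma ews_ratio_vector_on_line:
  assumes "ews E Labor Land \<noteq> 0"
  shows "ews_ratio_vector E \<in> ews_line E c"
proof -
  define a b d where "a = opposite_ews E Capital" and "b = opposite_ews E Land"
    and "d = opposite_ews E Labor"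
  have nz: "a \<noteq> 0" "income_share E Capital \<noteq> 0"
    using assms income_share_pos[of Labor] income_share_pos[of Capital]
    by (simp_all add: a_def sym_ews_def)
  \<comment> \<open>The equation of the line with its denominators cleared. Once the aggregates are
    written through reward gaps it is a polynomial identity.\<close>
  have "d * reward_gap c Capital Land * (income_share E Labor * agg_coeff_rate E c Labor)
      = a * reward_gap c Labor Land * (income_share E Capital * agg_coeff_rate E c Capital)
        - b * reward_gap c Labor Capital * (income_share E Land * agg_coeff_rate E c Land)"
    unfolding agg_coeff_rate_gaps reward_gap_def a_def b_def d_def by (simp add: algebra_simps)
  then show ?thesis
    unfolding ews_line_def ews_ratio_vector_opposite
      a_def[symmetric] b_def[symmetric] d_def[symmetric]
    using nz gap_KT agg_L by (simp add: divide_simps) (simp add: algebra_simps)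
qed

lemma line_meets_hyperbola:
  "line_meets_hyperbola (ews_slope c) (ews_intercept c)
     (income_share E Labor / income_share E Capital) (fst (point_A E c)) (fst (point_B E c))"
proof
  show "0 < income_share E Labor / income_share E Capital"
    using income_share_pos by simp
next
  have L: "reward_gap c Land Labor = - reward_gap c Labor Land"
    "reward_gap c Labor Capital = - reward_gap c Capital Labor"
    by (simp_all add: reward_gap_def)
  show "ews_intercept c = ews_slope c * (fst (point_A E c) * fst (point_B E c))"
    unfolding ews_intercept_def ews_slope_def point_A_def point_B_def L
    using gap_KL gap_KT agg_T agg_L income_share_pos[of Capital] income_share_pos[of Land]
    by (simp add: field_simps)
next
  have A: "1 + fst (point_A E c) = reward_gap c Capital Land / reward_gap c Capital Labor"
    using gap_KL unfolding point_A_def by (simp add: field_simps reward_gap_def)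
  have B: "1 + fst (point_B E c) = - (income_share E Labor * agg_coeff_rate E c Labor)
      / (income_share E Land * agg_coeff_rate E c Land)"
  proof -
    have *: "- (income_share E Labor * agg_coeff_rate E c Labor)
        = income_share E Land * agg_coeff_rate E c Land + income_share E Capital * agg_coeff_rate E c Capital"
      using sum_income_share_agg_coeff_rate[of c] by linarith
    show ?thesis
      using agg_T income_share_pos[of Land] unfolding * point_B_def by (simp add: field_simps)
  qed
  have L: "reward_gap c Labor Capital = - reward_gap c Capital Labor"
    by (simp add: reward_gap_def)
  show "ews_slope c * ((1 + fst (point_A E c)) * (1 + fst (point_B E c)))
      = - (income_share E Labor / income_share E Capital)"
    unfolding A B L ews_slope_def
    using gap_KL gap_KT agg_T agg_L income_share_pos[of Capital] income_share_pos[of Land]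
    by (simp add: field_simps)
qed

interpretation line_meets_hyperbola "ews_slope c" "ews_intercept c"
  "income_share E Labor / income_share E Capital" "fst (point_A E c)" "fst (point_B E c)"
  by (fact line_meets_hyperbola)

lemma on_line_graph:
  "P \<in> ews_line E c \<Longrightarrow> P = (fst P, ews_slope c * fst P + ews_intercept c)"
  unfolding ews_line_eq by (auto simp: prod_eq_iff)

text \<open>That the two points lie on the hyperbola needs no direct check: their abscissae satisfy
  Vieta's formulas and the points lie on the line.\<close>

lemma ews_line_Int_hyperbola: "ews_line E c \<inter> ews_hyperbola E = {point_A E c, point_B E c}"
proof -
  have "ews_hyperbola E = {(s, u). s \<noteq> -1
      \<and> u = - (income_share E Labor / income_share E Capital) * (s / (s + 1))}"
    by (simp add: ews_hyperbola_def)
  then show ?thesis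
    using intersection on_line_graph[OF point_A_on_line] on_line_graph[OF point_B_on_line]
    unfolding ews_line_eq by simp
qed

lemma same_branch_iff_slope: "same_branch (point_A E c) (point_B E c) \<longleftrightarrow> ews_slope c < 0"
  using same_branch_iff[of "snd (point_A E c)" "snd (point_B E c)"] by simp

lemma ews_ratio_vector_quadratic:
  assumes "ews E Labor Land \<noteq> 0"
  shows "0 < ews_slope c * ((fst (ews_ratio_vector E) - fst (point_A E c))
    * (fst (ews_ratio_vector E) - fst (point_B E c)))"
  using ews_ratio_vector_above_hyperbola[OF assms on_line_graph[OF ews_ratio_vector_on_line[OF assms]]]
  unfolding quadratic_factor .

lemma ews_ratio_vector_in_segment_iff:
  assumes "ews E Labor Land \<noteq> 0"
  shows "ews_ratio_vector E \<in> closed_segment (point_A E c) (point_B E c)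
    \<longleftrightarrow> same_branch (point_A E c) (point_B E c)"
  using segment_iff[OF ews_ratio_vector_above_hyperbola[OF assms
      on_line_graph[OF ews_ratio_vector_on_line[OF assms]]]]
    on_line_graph[OF point_A_on_line] on_line_graph[OF point_B_on_line]
    on_line_graph[OF ews_ratio_vector_on_line[OF assms]] same_branch_iff_slope
  by simp

end


section \<open>Rybczynski responses\<close>

text \<open>Multiplying each full-employment equation by its income share puts the symmetric matrix
  and the distributive shares in place of \<open>ews\<close> and \<open>alloc_share\<close>.\<close>

lemma differentiated_system_iff:
  "differentiated_system E c \<longleftrightarrow>
     (\<forall>j. (\<Sum>i\<in>UNIV. dist_share E i j * reward_rate c i) = price_rate c j) \<and>
     (\<forall>i. (\<Sum>h\<in>UNIV. sym_ews E i h * reward_rate c h)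
        + (\<Sum>j\<in>UNIV. dist_share E i j * (good_share E j * output_rate c j))
        = income_share E i * supply_rate c i)"
proof -
  have "(\<Sum>h\<in>UNIV. sym_ews E i h * reward_rate c h)
      + (\<Sum>j\<in>UNIV. dist_share E i j * (good_share E j * output_rate c j))
    = income_share E i * ((\<Sum>h\<in>UNIV. ews E i h * reward_rate c h)
      + (\<Sum>j\<in>UNIV. alloc_share E i j * output_rate c j))" for i
    unfolding sym_ews_def distrib_left sum_distrib_left mult.assoc[symmetric] income_share_alloc_share
    by (simp add: ac_simps)
  moreover have "income_share E i \<noteq> 0" for i
    using income_share_pos[of i] by simp
  ultimately show ?thesis
    unfolding differentiated_system_def by (simp add: sum_dist_share_coeff_rate)
qed

lemma sum_share_gap: "share_gap E Land = - share_gap E Capital - share_gap E Labor"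
  using sum_dist_share[of Good1] sum_dist_share[of Good2]
  unfolding share_gap_def sum_factor by simp

lemma response_num_dist_share:
  "(\<Sum>i\<in>UNIV. response_num E Good1 i * dist_share E i Good1) = response_det E"
  "(\<Sum>i\<in>UNIV. response_num E Good1 i * dist_share E i Good2) = 0"
  "(\<Sum>i\<in>UNIV. response_num E Good2 i * dist_share E i Good1) = 0"
  "(\<Sum>i\<in>UNIV. response_num E Good2 i * dist_share E i Good2) = response_det E"
proof -
  define A where "A = (\<Sum>h\<in>UNIV. opposite_ews E h * share_gap E h * dist_share E h Good1)"
  define B where "B = (\<Sum>h\<in>UNIV. opposite_ews E h * share_gap E h * dist_share E h Good2)"
  have AB: "response_det E = A - B"
    unfolding A_def B_def response_det_def sum_subtractf[symmetric]
    by (simp add: share_gap_def algebra_simps power2_eq_square)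
  have 1: "(\<Sum>i\<in>UNIV. response_num E Good1 i * z i)
      = (\<Sum>i\<in>UNIV. opposite_ews E i * share_gap E i * z i) - B * (\<Sum>i\<in>UNIV. z i)" for z
    unfolding response_num.simps B_def[symmetric]
    by (simp add: left_diff_distrib sum_subtractf sum_distrib_left)
  have 2: "(\<Sum>i\<in>UNIV. response_num E Good2 i * z i)
      = A * (\<Sum>i\<in>UNIV. z i) - (\<Sum>i\<in>UNIV. opposite_ews E i * share_gap E i * z i)" for z
    unfolding response_num.simps A_def[symmetric]
    by (simp add: left_diff_distrib sum_subtractf sum_distrib_left)
  show "(\<Sum>i\<in>UNIV. response_num E Good1 i * dist_share E i Good1) = response_det E"
    "(\<Sum>i\<in>UNIV. response_num E Good1 i * dist_share E i Good2) = 0"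
    "(\<Sum>i\<in>UNIV. response_num E Good2 i * dist_share E i Good1) = 0"
    "(\<Sum>i\<in>UNIV. response_num E Good2 i * dist_share E i Good2) = response_det E"
    unfolding 1 2 sum_dist_share by (simp_all add: AB A_def B_def)
qed

text \<open>Centering constants are killed by the zero column sums. On vectors with zero sum, such
  as the share gaps, weighting by \<open>opposite_ews\<close> inverts \<open>sym_ews\<close> up to
  the factor \<open>- m\<close>.\<close>

lemma response_num_sym_ews:
  defines "m \<equiv> opposite_ews E Land * opposite_ews E Capital
     + opposite_ews E Land * opposite_ews E Labor + opposite_ews E Capital * opposite_ews E Labor"
  shows "(\<Sum>i\<in>UNIV. response_num E Good1 i * sym_ews E i h) = - m * share_gap E h"
    and "(\<Sum>i\<in>UNIV. response_num E Good2 i * sym_ews E i h) = m * share_gap E h"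
proof -
  have col: "(\<Sum>i\<in>UNIV. sym_ews E i h) = 0"
    using sum_sym_ews[of h] by (simp add: sym_ews_commute[of _ h])
  have gap: "(\<Sum>i\<in>UNIV. opposite_ews E i * share_gap E i * sym_ews E i h) = - m * share_gap E h"
    unfolding m_def sum_factor
    by (cases h; simp only: sym_ews_opposite sum_share_gap) (simp_all add: algebra_simps)
  show "(\<Sum>i\<in>UNIV. response_num E Good1 i * sym_ews E i h) = - m * share_gap E h"
    "(\<Sum>i\<in>UNIV. response_num E Good2 i * sym_ews E i h) = m * share_gap E h"
    using gap col unfolding response_num.simps
    by (simp_all add: left_diff_distrib sum_subtractf flip: sum_distrib_left)
qed

text \<open>The vector \<open>response_num E j\<close> is orthogonal to the factor shares of the other good, and the
  substitution matrix maps it to a multiple of \<open>share_gap E\<close>, which is orthogonal to the reward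
  changes. Pairing it with the full-employment equations therefore isolates the output of \<open>j\<close>.\<close>

lemma output_rate_determined:
  assumes sys: "differentiated_system E c" and price: "\<forall>k. price_rate c k = 0"
  shows "response_det E * (good_share E j * output_rate c j)
    = (\<Sum>i\<in>UNIV. response_num E j i * (income_share E i * supply_rate c i))"
proof -
  have gap: "(\<Sum>h\<in>UNIV. share_gap E h * reward_rate c h) = 0"
    using sys price unfolding differentiated_system_iff share_gap_def
    by (simp add: left_diff_distrib sum_subtractf)
  then have zero: "(\<Sum>h\<in>UNIV. (\<Sum>i\<in>UNIV. response_num E j i * sym_ews E i h) * reward_rate c h) = 0"
    by (cases j) (simp_all add: response_num_sym_ews mult.assoc sum_negf
        flip: sum_distrib_left del: response_num.simps)
  have "(\<Sum>i\<in>UNIV. response_num E j i * (income_share E i * supply_rate c i))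
    = (\<Sum>i\<in>UNIV. response_num E j i * ((\<Sum>h\<in>UNIV. sym_ews E i h * reward_rate c h)
        + (\<Sum>k\<in>UNIV. dist_share E i k * (good_share E k * output_rate c k))))"
    using sys unfolding differentiated_system_iff by simp
  also have "\<dots> = (\<Sum>h\<in>UNIV. (\<Sum>i\<in>UNIV. response_num E j i * sym_ews E i h) * reward_rate c h)
      + (\<Sum>k\<in>UNIV. (\<Sum>i\<in>UNIV. response_num E j i * dist_share E i k)
          * (good_share E k * output_rate c k))"
    unfolding sum_factor sum_good by (simp add: algebra_simps del: response_num.simps)
  also have "\<dots> = response_det E * (good_share E j * output_rate c j)"
    unfolding zero sum_good
    by (cases j) (simp_all add: response_num_dist_share del: response_num.simps)
  finally show ?thesis ..
qed

text \<open>The cross product of the share vectors of the two goods, in the order land, capital,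
  labor.\<close>

fun share_cross :: "factor \<Rightarrow> real" where
  "share_cross Land = dist_share E Capital Good1 * dist_share E Labor Good2
     - dist_share E Labor Good1 * dist_share E Capital Good2"
| "share_cross Capital = dist_share E Labor Good1 * dist_share E Land Good2
     - dist_share E Land Good1 * dist_share E Labor Good2"
| "share_cross Labor = dist_share E Land Good1 * dist_share E Capital Good2
     - dist_share E Capital Good1 * dist_share E Land Good2"

lemma sum_dist_share_cross: "(\<Sum>i\<in>UNIV. dist_share E i j * share_cross i) = 0"
  unfolding sum_factor by (cases j) (simp_all add: algebra_simps)

text \<open>States that rewards \<open>- share_cross k * share_cross h\<close> and outputs
  \<open>response_num E j h\<close>, both over \<open>response_det E\<close>, solve the weighted
  full-employment equations for a unit right-hand side at \<open>h\<close>.\<close>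

lemma response_inverse:
  "(\<Sum>j\<in>UNIV. dist_share E i j * response_num E j h)
     - (\<Sum>k\<in>UNIV. sym_ews E i k * share_cross k) * share_cross h
   = (if i = h then response_det E else 0)"
proof -
  \<comment> \<open>The identity depends on shares summing to one; eliminating the land shares makes
    all nine cases polynomial identities.\<close>
  have L: "dist_share E Land j = 1 - dist_share E Capital j - dist_share E Labor j" for j
    using sum_dist_share[of j] unfolding sum_factor by simp
  define a b d where "a = opposite_ews E Capital" and "b = opposite_ews E Land"
    and "d = opposite_ews E Labor"
  show ?thesis
    unfolding response_det_def sum_factor sum_good
    by (cases i; cases h;
        simp only: response_num.simps sum_factor share_cross.simps sym_ews_opposite share_gap_def L
          a_def[symmetric] b_def[symmetric] d_def[symmetric] factor.simps if_True if_False refl)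
      (simp_all add: algebra_simps power2_eq_square)
qed

lemma supply_response_exists:
  assumes "response_det E \<noteq> 0"
  shows "\<exists>c. differentiated_system E c \<and> (\<forall>k. price_rate c k = 0) \<and> supply_rate c = v"
proof -
  define y where "y i = income_share E i * v i / response_det E" for i
  define c where "c = \<lparr>reward_rate = \<lambda>i. - share_cross i * (\<Sum>h\<in>UNIV. share_cross h * y h),
    output_rate = \<lambda>j. (\<Sum>h\<in>UNIV. response_num E j h * y h) / good_share E j,
    price_rate = \<lambda>j. 0, supply_rate = v\<rparr>"
  have outputs: "good_share E j * output_rate c j = (\<Sum>h\<in>UNIV. response_num E j h * y h)" for j
    using good_share_pos[of j] by (simp add: c_def del: response_num.simps)
  have "(\<Sum>i\<in>UNIV. dist_share E i j * reward_rate c i) = price_rate c j" for j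
  proof -
    have "(\<Sum>i\<in>UNIV. dist_share E i j * reward_rate c i)
      = - (\<Sum>h\<in>UNIV. share_cross h * y h) * (\<Sum>i\<in>UNIV. dist_share E i j * share_cross i)"
      unfolding c_def sum_factor by (simp add: algebra_simps del: share_cross.simps)
    then show ?thesis
      by (simp add: sum_dist_share_cross c_def del: share_cross.simps)
  qed
  moreover have "(\<Sum>h\<in>UNIV. sym_ews E i h * reward_rate c h)
        + (\<Sum>j\<in>UNIV. dist_share E i j * (good_share E j * output_rate c j))
        = income_share E i * supply_rate c i" for i
  proof -
    have "(\<Sum>h\<in>UNIV. sym_ews E i h * reward_rate c h)
        + (\<Sum>j\<in>UNIV. dist_share E i j * (good_share E j * output_rate c j))
      = (\<Sum>h\<in>UNIV. ((\<Sum>j\<in>UNIV. dist_share E i j * response_num E j h)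
          - (\<Sum>k\<in>UNIV. sym_ews E i k * share_cross k) * share_cross h) * y h)"
      unfolding outputs by (simp add: c_def sum_factor sum_good algebra_simps del: share_cross.simps response_num.simps)
    also have "\<dots> = response_det E * y i"
      unfolding response_inverse by (cases i) (simp_all add: sum_factor)
    finally show ?thesis
      using assms by (simp add: y_def c_def)
  qed
  ultimately show ?thesis
    unfolding differentiated_system_iff by (intro exI[of _ c]) (simp add: c_def)
qed

text \<open>The definite description denotes: \<open>output_rate_determined\<close> forces the
  value, and \<open>supply_response_exists\<close> for a unit change of one supply provides a
  witness.\<close>

lemma rybczynski_eq:
  assumes "response_det E \<noteq> 0"
  shows "rybczynski E j i
    = income_share E i * response_num E j i / (good_share E j * response_det E)"
proof -
  define R where "R r \<longleftrightarrow> (\<exists>c. differentiated_system E c \<and> (\<forall>k. price_rate c k = 0) \<and>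
    (\<forall>h. h \<noteq> i \<longrightarrow> supply_rate c h = 0) \<and> supply_rate c i \<noteq> 0 \<and>
    r = output_rate c j / supply_rate c i)" for r
  have R_val: "r = income_share E i * response_num E j i / (good_share E j * response_det E)"
    if "R r" for r
  proof -
    from that obtain c where c: "differentiated_system E c" "\<forall>k. price_rate c k = 0"
      "\<forall>h. h \<noteq> i \<longrightarrow> supply_rate c h = 0" "supply_rate c i \<noteq> 0"
      "r = output_rate c j / supply_rate c i"
      unfolding R_def by blast
    have "(\<Sum>h\<in>UNIV. response_num E j h * (income_share E h * supply_rate c h))
        = (\<Sum>h\<in>{i}. response_num E j h * (income_share E h * supply_rate c h))"
      using c(3) by (intro sum.mono_neutral_right) auto
    then have "response_det E * (good_share E j * output_rate c j)
        = response_num E j i * (income_share E i * supply_rate c i)"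
      using output_rate_determined[OF c(1,2), of j] by (simp del: response_num.simps)
    moreover have "output_rate c j = r * supply_rate c i"
      using c(4,5) by simp
    ultimately have "supply_rate c i * (r * (good_share E j * response_det E))
        = supply_rate c i * (income_share E i * response_num E j i)"
      by (simp add: ac_simps del: response_num.simps)
    then show ?thesis
      using c(4) assms good_share_pos[of j] by (simp add: eq_divide_eq del: response_num.simps)
  qed
  obtain c where c: "differentiated_system E c" "\<forall>k. price_rate c k = 0"
    "supply_rate c = (\<lambda>h. if h = i then 1 else 0)"
    using supply_response_exists[OF assms] by blast
  then have "R (output_rate c j / supply_rate c i)"
    unfolding R_def by (intro exI[of _ c]) simp
  then have "(THE r. R r) = income_share E i * response_num E j i / (good_share E j * response_det E)"
    by (metis R_val the_equality)
  then show ?thesis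
    unfolding rybczynski_def R_def .
qed

lemma sgn_rybczynski:
  assumes "0 < response_det E"
  shows "sgn (rybczynski E j i) = sgn (response_num E j i)"
  using assms income_share_pos[of i] good_share_pos[of j]
  by (simp add: rybczynski_eq sgn_mult sgn_divide del: response_num.simps)

text \<open>With a positive determinant, this rules out that both outputs fail to rise when a supply
  increases.\<close>

lemma response_num_sum: "response_num E Good1 i + response_num E Good2 i = response_det E"
  unfolding response_det_def sum_factor
  by (simp add: sum_factor share_gap_def algebra_simps power2_eq_square)

lemma labor_border_response_num:
  assumes "0 < ews E Labor Land"
  shows "sgn (labor_border E Good2 (ews_ratio_vector E)) = sgn (response_num E Good1 Labor)"
    and "sgn (labor_border E Good1 (ews_ratio_vector E)) = - sgn (response_num E Good2 Labor)"
proof -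
  define a b d where "a = opposite_ews E Capital" and "b = opposite_ews E Land"
    and "d = opposite_ews E Labor"
  \<comment> \<open>The positive factor between border and numerator: \<open>1 / a\<close> is the
    common denominator of the EWS ratios, and the labor income share is common to all three
    terms.\<close>
  define r where "r = income_share E Labor / a"
  have a: "0 < a"
    using assms income_share_pos[of Labor] by (simp add: a_def sym_ews_def)
  then have r: "0 < r"
    using income_share_pos by (simp add: r_def)
  have K: "dist_share E Capital j + dist_share E Land j = 1 - dist_share E Labor j" for j
    using sum_dist_share[of j] unfolding sum_factor by simp
  have border: "labor_border E j (ews_ratio_vector E) = r * (d * share_gap E Labor * (1 - dist_share E Labor j)
      - b * share_gap E Land * dist_share E Land j - a * share_gap E Capital * dist_share E Capital j)" for j
    unfolding labor_border_def ews_ratio_vector_opposite r_def share_gap_def K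
      a_def[symmetric] b_def[symmetric] d_def[symmetric]
    using a income_share_pos[of Capital] by (simp add: field_simps)
  have "labor_border E Good2 (ews_ratio_vector E) = r * response_num E Good1 Labor"
    unfolding border response_num.simps sum_factor a_def b_def d_def by (simp add: algebra_simps)
  then show "sgn (labor_border E Good2 (ews_ratio_vector E)) = sgn (response_num E Good1 Labor)"
    using r by (simp add: sgn_mult del: response_num.simps)
  have "labor_border E Good1 (ews_ratio_vector E) = - (r * response_num E Good2 Labor)"
    unfolding border response_num.simps sum_factor a_def b_def d_def by (simp add: algebra_simps)
  then show "sgn (labor_border E Good1 (ews_ratio_vector E)) = - sgn (response_num E Good2 Labor)"
    using r by (simp add: sgn_mult sgn_minus del: response_num.simps)
qed


section \<open>The sign pattern in quadrant IV\<close>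

text \<open>Because the share gaps sum to zero, the labor gap is minus the sum of the other two,
  which gives the shape required by \<open>opposite_ews_quadratic_form_pos\<close>.\<close>

lemma response_det_eq_share_gap_form:
  "response_det E = opposite_ews E Capital * (share_gap E Capital)\<^sup>2
     + opposite_ews E Land * (share_gap E Land)\<^sup>2
     + opposite_ews E Labor * (share_gap E Capital + share_gap E Land)\<^sup>2"
  unfolding response_det_def sum_factor sum_share_gap
  by (simp add: algebra_simps power2_eq_square)

lemma response_num_expand:
  "response_num E Good1 i = opposite_ews E i * share_gap E i
     - opposite_ews E Land * (share_gap E Land * dist_share E Land Good2)
     - opposite_ews E Capital * (share_gap E Capital * dist_share E Capital Good2)
     - opposite_ews E Labor * (share_gap E Labor * dist_share E Labor Good2)"
  "response_num E Good2 i =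
     opposite_ews E Land * (share_gap E Land * dist_share E Land Good1)
     + opposite_ews E Capital * (share_gap E Capital * dist_share E Capital Good1)
     + opposite_ews E Labor * (share_gap E Labor * dist_share E Labor Good1)
     - opposite_ews E i * share_gap E i"
  by (simp_all add: sum_factor algebra_simps)

section \<open>Response signs under the factor-intensity ranking\<close>

context
  assumes land: "dist_share E Land Good1 / dist_share E Land Good2
      > dist_share E Labor Good1 / dist_share E Labor Good2"
    and capital: "dist_share E Labor Good1 / dist_share E Labor Good2
      > dist_share E Capital Good1 / dist_share E Capital Good2"
    and labor: "dist_share E Labor Good1 > dist_share E Labor Good2"
begin

lemma share_gap_signs:
  "0 < share_gap E Labor" "0 < share_gap E Land" "share_gap E Capital < 0"
proof -
  show L: "0 < share_gap E Labor"
    using labor by (simp add: share_gap_def)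
  have "1 < dist_share E Labor Good1 / dist_share E Labor Good2"
    using labor dist_share_pos by simp
  then have "1 < dist_share E Land Good1 / dist_share E Land Good2"
    using land by linarith
  then show T: "0 < share_gap E Land"
    using dist_share_pos[of Land Good2] by (simp add: share_gap_def)
  show "share_gap E Capital < 0"
    using L T sum_share_gap by linarith
qed

lemma response_det_pos: "0 < response_det E"
  unfolding response_det_eq_share_gap_form
  using share_gap_signs by (intro opposite_ews_quadratic_form_pos) auto

text \<open>Merging the leading term with the land term of the mean leaves a factor
  \<open>1 - dist_share E Land j\<close>; all three remaining summands then push in the same
  direction.\<close>

lemma response_num_Land:
  assumes "0 < opposite_ews E Land" "0 < opposite_ews E Capital" "opposite_ews E Labor < 0"
  shows "0 < response_num E Good1 Land" and "response_num E Good2 Land < 0"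
proof -
  have less_1: "dist_share E Land j < 1" for j
    using sum_dist_share[of j] dist_share_pos[of Capital j] dist_share_pos[of Labor j]
    unfolding sum_factor by linarith
  have "0 < opposite_ews E Land * (share_gap E Land * (1 - dist_share E Land j))"
    "opposite_ews E Capital * (share_gap E Capital * dist_share E Capital j) < 0"
    "opposite_ews E Labor * (share_gap E Labor * dist_share E Labor j) < 0" for j
    using assms share_gap_signs dist_share_pos[of _ j] less_1[of j]
    by (simp_all add: mult_pos_neg mult_neg_pos)
  from this[of Good1] this[of Good2]
  show "0 < response_num E Good1 Land" and "response_num E Good2 Land < 0"
    unfolding response_num_expand by (simp_all add: right_diff_distrib)
qed

text \<open>Complementarity of land and capital works against this sign. The determinant condition
  bounds it by \<open>- opposite_ews E Labor < opposite_ews E Capital\<close>, and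
  \<open>share_gap E Labor < - share_gap E Capital\<close> because share gaps sum to zero.\<close>

lemma response_num_Capital:
  assumes "0 < opposite_ews E Land" "0 < opposite_ews E Capital" "opposite_ews E Labor < 0"
  shows "response_num E Good1 Capital < 0" and "0 < response_num E Good2 Capital"
proof -
  \<comment> \<open>One inequality covers both goods: at \<open>Good2\<close> the expression is
    minus the numerator for \<open>Good1\<close>, at \<open>Good1\<close> it is the numerator for
    \<open>Good2\<close>.\<close>
  have main: "0 < opposite_ews E Capital * (- share_gap E Capital * (1 - dist_share E Capital j))
      + opposite_ews E Land * (share_gap E Land * dist_share E Land j)
      + opposite_ews E Labor * (share_gap E Labor * dist_share E Labor j)" for j
  proof -
    have share: "dist_share E Labor j < 1 - dist_share E Capital j"
      using sum_dist_share[of j] dist_share_pos[of Land j] unfolding sum_factor by linarith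
    have gap: "share_gap E Labor < - share_gap E Capital"
      using sum_share_gap share_gap_signs by linarith
    have ews: "- opposite_ews E Labor < opposite_ews E Capital"
      using opposite_ews_sum_pos by linarith
    have "share_gap E Labor * dist_share E Labor j < - share_gap E Capital * (1 - dist_share E Capital j)"
      using share gap share_gap_signs dist_share_pos[of Labor j]
      by (intro mult_strict_mono) auto
    moreover have "0 < share_gap E Labor * dist_share E Labor j"
      using share_gap_signs dist_share_pos[of Labor j] by simp
    ultimately have "- opposite_ews E Labor * (share_gap E Labor * dist_share E Labor j)
        < opposite_ews E Capital * (- share_gap E Capital * (1 - dist_share E Capital j))"
      using ews assms by (intro mult_strict_mono[of "- opposite_ews E Labor"]) auto
    moreover have "0 < opposite_ews E Land * (share_gap E Land * dist_share E Land j)"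
      using assms share_gap_signs dist_share_pos[of Land j] by simp
    ultimately show ?thesis
      by simp
  qed
  from main[of Good2] show "response_num E Good1 Capital < 0"
    unfolding response_num_expand by (simp add: algebra_simps)
  from main[of Good1] show "0 < response_num E Good2 Capital"
    unfolding response_num_expand by (simp add: algebra_simps)
qed

end

text \<open>The determinant condition makes the substitution form negative definite modulo common
  changes of all rewards, so aggregate input responses covary negatively with reward changes.\<close>

lemma point_A_left_of_point_B:
  assumes "reward_gap c Land Labor > 0" and "reward_gap c Labor Capital > 0"
    and "agg_coeff_rate E c Land > 0"
  shows "fst (point_A E c) < fst (point_B E c)"
proof -
  define x y where "x = reward_gap c Land Labor" and "y = reward_gap c Labor Capital"
  have g: "reward_gap c Labor Land = - x" "reward_gap c Capital Land = - (x + y)"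
    "reward_gap c Land Capital = x + y" "reward_gap c Capital Labor = - y"
    by (simp_all add: x_def y_def reward_gap_def)
  have xy: "0 < x" "0 < y"
    using assms by (simp_all add: x_def y_def)
  define T K where "T = income_share E Land * agg_coeff_rate E c Land"
    and "K = income_share E Capital * agg_coeff_rate E c Capital"
  have T: "0 < T"
    using assms income_share_pos by (simp add: T_def)
  have "0 < opposite_ews E Capital * x\<^sup>2 + opposite_ews E Land * y\<^sup>2 + opposite_ews E Labor * (x + y)\<^sup>2"
    using xy by (intro opposite_ews_quadratic_form_pos) auto
  \<comment> \<open>Minus the sum of weighted aggregates times reward changes, after the labor
    aggregate is replaced by minus the other two. Division by \<open>T * y\<close> yields the order
    of the abscissae.\<close>
  also have "\<dots> = K * y - T * x"
    unfolding T_def K_def agg_coeff_rate_gaps g y_def[symmetric]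
    by (simp add: algebra_simps power2_eq_square)
  finally have "x / y < K / T"
    using xy T by (simp add: field_simps)
  moreover have "fst (point_A E c) = x / y" "fst (point_B E c) = K / T"
    unfolding point_A_def g K_def T_def point_B_def x_def[symmetric] by (simp_all add: mult.commute)
  ultimately show ?thesis
    by simp
qed

section \<open>Land reward rising most, capital least, with aggregates of signs plus, plus, minus
  for land, capital, labor\<close>

context
  fixes c :: rates
  assumes gap_TL: "reward_gap c Land Labor > 0"
    and gap_LK: "reward_gap c Labor Capital > 0"
    and agg_T_pos: "agg_coeff_rate E c Land > 0"
    and agg_K_pos: "agg_coeff_rate E c Capital > 0"
    and agg_L_neg: "agg_coeff_rate E c Labor < 0"
begin

lemma gap_signs:
  "reward_gap c Labor Land < 0" "reward_gap c Capital Labor < 0"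
  "reward_gap c Capital Land < 0" "reward_gap c Land Capital > 0"
  using gap_TL gap_LK by (simp_all add: reward_gap_def)

text \<open>Otherwise land would respond only to capital, as a substitute; since capital becomes
  cheaper relative to land, the land aggregate would fall.\<close>

lemma ews_Labor_Land_nonzero: "ews E Labor Land \<noteq> 0"
proof
  assume "ews E Labor Land = 0"
  then have a: "opposite_ews E Capital = 0"
    by (simp add: sym_ews_def)
  then have "0 < opposite_ews E Labor"
    using opposite_ews_sum_pos(3) by simp
  then have "income_share E Land * agg_coeff_rate E c Land < 0"
    unfolding agg_coeff_rate_gaps a using gap_signs by (simp add: mult_pos_neg del: opposite_ews.simps)
  then show False
    using agg_T_pos income_share_pos[of Land] by (simp add: mult_less_0_iff)
qed

lemma point_A_quadrant_IV: "point_A E c \<in> quadrant_IV"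
  unfolding point_A_def quadrant_IV_def
  using gap_TL gap_signs income_share_pos[of Labor] income_share_pos[of Capital]
  by (auto simp: divide_less_0_iff zero_less_divide_iff mult_less_0_iff)

lemma point_B_quadrant_IV: "point_B E c \<in> quadrant_IV"
  unfolding point_B_def quadrant_IV_def
  using agg_T_pos agg_K_pos agg_L_neg income_share_pos[of Land] income_share_pos[of Capital]
  by (auto simp: divide_less_0_iff)

lemma ews_slope_neg: "ews_slope c < 0"
proof -
  have "same_branch (point_A E c) (point_B E c)"
    using point_A_quadrant_IV point_B_quadrant_IV by (auto simp: same_branch_def quadrant_IV_def)
  then show ?thesis
    using same_branch_iff_slope gap_signs agg_T_pos agg_L_neg by simp
qed

text \<open>The quadratic is strictly positive while its leading coefficient is negative, so the
  abscissa is strictly between the roots; the negative slope reverses the order for the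
  ordinates.\<close>

lemma ews_ratio_vector_between:
  "fst (point_A E c) < fst (ews_ratio_vector E)" "fst (ews_ratio_vector E) < fst (point_B E c)"
  "snd (ews_ratio_vector E) < snd (point_A E c)" "snd (point_B E c) < snd (ews_ratio_vector E)"
proof -
  note nz = gap_signs(2,3)[THEN less_imp_neq] agg_T_pos[THEN less_imp_neq, symmetric]
    agg_L_neg[THEN less_imp_neq]
  define s x y where "s = fst (ews_ratio_vector E)" and "x = fst (point_A E c)"
    and "y = fst (point_B E c)"
  have "0 < ews_slope c * ((s - x) * (s - y))"
    unfolding s_def x_def y_def by (intro ews_ratio_vector_quadratic nz ews_Labor_Land_nonzero)
  then have "(s - x) * (s - y) < 0"
    using ews_slope_neg by (simp add: zero_less_mult_iff)
  moreover have "x < y"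
    unfolding x_def y_def using gap_TL gap_LK agg_T_pos by (rule point_A_left_of_point_B)
  ultimately have s: "x < s" "s < y"
    by (auto simp: mult_less_0_iff)
  then show "fst (point_A E c) < fst (ews_ratio_vector E)"
    "fst (ews_ratio_vector E) < fst (point_B E c)"
    by (simp_all add: s_def x_def y_def)
  have snd: "snd P = ews_slope c * fst P + ews_intercept c" if "P \<in> ews_line E c" for P
    using that unfolding ews_line_eq by auto
  show "snd (ews_ratio_vector E) < snd (point_A E c)" "snd (point_B E c) < snd (ews_ratio_vector E)"
    using s ews_slope_neg
    by (simp_all add: snd point_A_on_line point_B_on_line ews_ratio_vector_on_line nz
        ews_Labor_Land_nonzero s_def x_def y_def)
qed

lemma ews_ratio_vector_quadrant_IV: "ews_ratio_vector E \<in> quadrant_IV"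
  using ews_ratio_vector_between point_A_quadrant_IV
  unfolding quadrant_IV_def mem_Collect_eq case_prod_beta by linarith

lemma ews_ratio_vector_in_segment:
  "ews_ratio_vector E \<in> closed_segment (point_A E c) (point_B E c)"
  using ews_ratio_vector_in_segment_iff ews_Labor_Land_nonzero same_branch_iff_slope ews_slope_neg
    gap_signs agg_T_pos agg_L_neg by simp

text \<open>The quadrant fixes signs of ratios only. The common denominator must be positive because
  \<open>b / a > 0\<close> and \<open>b + a > 0\<close>.\<close>

lemma opposite_ews_signs:
  "0 < opposite_ews E Land" "0 < opposite_ews E Capital" "opposite_ews E Labor < 0"
proof -
  define a b d where "a = opposite_ews E Capital" and "b = opposite_ews E Land"
    and "d = opposite_ews E Labor"
  define r where "r = income_share E Labor / income_share E Capital"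
  have "0 < r"
    using income_share_pos by (simp add: r_def)
  moreover have "0 < b / a" "r * (d / a) < 0"
    using ews_ratio_vector_quadrant_IV
    unfolding ews_ratio_vector_opposite quadrant_IV_def a_def[symmetric] b_def[symmetric]
      d_def[symmetric] r_def[symmetric]
    by simp_all
  moreover have "0 < b + a"
    using opposite_ews_sum_pos(1) by (simp add: a_def b_def)
  ultimately have "0 < b \<and> 0 < a \<and> d < 0"
    by (auto simp: zero_less_divide_iff divide_less_0_iff mult_less_0_iff)
  then show "0 < opposite_ews E Land" "0 < opposite_ews E Capital" "opposite_ews E Labor < 0"
    by (simp_all add: a_def b_def d_def)
qed

lemma land_capital_complements:
  "ews_complements E Capital Land" "ews_complements E Land Capital"
proof -
  have "sym_ews E Capital Land < 0"
    using opposite_ews_signs(3) by simp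
  moreover from this have "sym_ews E Land Capital < 0"
    by (simp add: sym_ews_commute[of Land Capital])
  ultimately show "ews_complements E Capital Land" "ews_complements E Land Capital"
    using income_share_pos[of Land] income_share_pos[of Capital]
    by (simp_all add: ews_complements_def sym_ews_def mult_less_0_iff)
qed

lemma ews_Labor_Land_pos: "0 < ews E Labor Land"
  using opposite_ews_signs(2) income_share_pos[of Labor] by (simp add: sym_ews_def zero_less_mult_iff)

end

end

section \<open>Assembling the segment estimate and the sign patterns\<close>

lemma quadrant_IV_convex: "convex quadrant_IV"
proof -
  have *: "quadrant_IV = {0<..} \<times> {..<0}"
    by (auto simp: quadrant_IV_def)
  show ?thesis
    unfolding * by (intro convex_Times convex_real_interval)
qed

lemma strong_rybczynski_signs:
  "strong_rybczynski E \<longleftrightarrow> sgn (rybczynski E Good1 Land) = 1 \<and> sgn (rybczynski E Good2 Land) = -1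
     \<and> sgn (rybczynski E Good1 Capital) = -1 \<and> sgn (rybczynski E Good2 Capital) = 1"
  by (simp add: strong_rybczynski_def sgn_1_pos sgn_1_neg)

text \<open>The general segment claim is an equivalence because, with A and B on different branches,
  the vector is on the line but outside the segment. Nonzero labor responses exclude the border
  lines, where an entry of the sign matrix vanishes.\<close>

theorem theorem1:
  fixes E :: economy and c :: rates
  assumes "technology E" and "equilibrium E" and "substitution_properties E"
    and "differentiated_system E c"
    and "dist_share E Land Good1 / dist_share E Land Good2
           > dist_share E Labor Good1 / dist_share E Labor Good2"
    and "dist_share E Labor Good1 / dist_share E Labor Good2
           > dist_share E Capital Good1 / dist_share E Capital Good2"
    and "dist_share E Labor Good1 > dist_share E Labor Good2"
    and "price_rate c Good1 - price_rate c Good2 > 0"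
  shows
    "(ews E Labor Land \<noteq> 0 \<and> reward_gap c Capital Labor \<noteq> 0 \<and> reward_gap c Capital Land \<noteq> 0 \<and>
     agg_coeff_rate E c Land \<noteq> 0 \<and> agg_coeff_rate E c Labor \<noteq> 0 \<longrightarrow>
       ews_line E c \<inter> ews_hyperbola E = {point_A E c, point_B E c} \<and>
       ews_ratio_vector E \<in> ews_line E c \<and>
       (ews_ratio_vector E \<in> closed_segment (point_A E c) (point_B E c)
          \<longleftrightarrow> same_branch (point_A E c) (point_B E c)))
     \<and>
     (reward_rate_rel c Land > reward_rate_rel c Labor \<and>
       reward_rate_rel c Labor > reward_rate_rel c Capital
     \<longleftrightarrow> reward_rate c Land > reward_rate c Labor \<and> reward_rate c Labor > reward_rate c Capital)
     \<and>
     (reward_rate_rel c Land > reward_rate_rel c Labor \<and>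
     reward_rate_rel c Labor > reward_rate_rel c Capital \<and>
     agg_coeff_rate E c Land > 0 \<and> agg_coeff_rate E c Capital > 0 \<and> agg_coeff_rate E c Labor < 0
     \<longrightarrow>
       ews E Labor Land \<noteq> 0 \<and>
       point_A E c \<in> quadrant_IV \<and> point_B E c \<in> quadrant_IV \<and>
       fst (point_A E c) < fst (point_B E c) \<and>
       closed_segment (point_A E c) (point_B E c) \<subseteq> quadrant_IV \<and>
       ews_ratio_vector E \<in> closed_segment (point_A E c) (point_B E c) \<and>
       ews_ratio_vector E \<in> quadrant_IV \<and>
       (0 < - reward_gap c Land Labor / reward_gap c Capital Labor \<and>
        - reward_gap c Land Labor / reward_gap c Capital Labor < fst (ews_ratio_vector E) \<and>
        fst (ews_ratio_vector E)
          < agg_coeff_rate E c Capital / agg_coeff_rate E c Land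
              * (income_share E Capital / income_share E Land)) \<and>
       (0 > income_share E Labor / income_share E Capital
              * (- reward_gap c Labor Land / reward_gap c Capital Land) \<and>
        income_share E Labor / income_share E Capital
              * (- reward_gap c Labor Land / reward_gap c Capital Land)
          > snd (ews_ratio_vector E) \<and>
        snd (ews_ratio_vector E) > agg_coeff_rate E c Capital / agg_coeff_rate E c Labor) \<and>
       ews_complements E Capital Land \<and> ews_complements E Land Capital \<and>
       strong_rybczynski E \<and>
       (rybczynski E Good1 Labor \<noteq> 0 \<and> rybczynski E Good2 Labor \<noteq> 0 \<longrightarrow>
          rybczynski_signs E \<in>
            {[[1, -1, -1], [-1, 1, 1]],
             [[1, -1, 1], [-1, 1, 1]],
             [[1, -1, 1], [-1, 1, -1]]}) \<and>
       (rybczynski_signs E = [[1, -1, -1], [-1, 1, 1]]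
          \<longleftrightarrow> labor_border E Good2 (ews_ratio_vector E) < 0) \<and>
       (rybczynski_signs E = [[1, -1, 1], [-1, 1, 1]]
          \<longleftrightarrow> labor_border E Good1 (ews_ratio_vector E) < 0
              \<and> labor_border E Good2 (ews_ratio_vector E) > 0) \<and>
       (rybczynski_signs E = [[1, -1, 1], [-1, 1, -1]]
          \<longleftrightarrow> labor_border E Good1 (ews_ratio_vector E) > 0))"
proof -
  interpret economy_equilibrium E
    using assms(1-3) by unfold_locales
  note resp_sgn = sgn_rybczynski[OF response_det_pos[OF assms(5-7)]]
  have line: "ews_line E c \<inter> ews_hyperbola E = {point_A E c, point_B E c} \<and>
       ews_ratio_vector E \<in> ews_line E c \<and>
       (ews_ratio_vector E \<in> closed_segment (point_A E c) (point_B E c)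
          \<longleftrightarrow> same_branch (point_A E c) (point_B E c))"
    if "ews E Labor Land \<noteq> 0 \<and> reward_gap c Capital Labor \<noteq> 0 \<and> reward_gap c Capital Land \<noteq> 0 \<and>
     agg_coeff_rate E c Land \<noteq> 0 \<and> agg_coeff_rate E c Labor \<noteq> 0"
    using that ews_line_Int_hyperbola ews_ratio_vector_on_line ews_ratio_vector_in_segment_iff
    by blast
  show ?thesis (is "(?D \<longrightarrow> ?L) \<and> ?R \<and> (?S \<longrightarrow> ?Q)")
  proof (intro conjI[of "?D \<longrightarrow> ?L"] conjI[of ?R] impI)
    show ?R
      by (simp add: reward_rate_rel_def)
  next
    assume ?S
    then have S: "reward_gap c Land Labor > 0" "reward_gap c Labor Capital > 0"
      "agg_coeff_rate E c Land > 0" "agg_coeff_rate E c Capital > 0" "agg_coeff_rate E c Labor < 0"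
      by (simp_all add: reward_gap_def reward_rate_rel_def)
    note between = ews_ratio_vector_between[OF S]
    note opp = opposite_ews_signs[OF S]
    have border: "sgn (labor_border E Good2 (ews_ratio_vector E)) = sgn (rybczynski E Good1 Labor)"
      "sgn (labor_border E Good1 (ews_ratio_vector E)) = - sgn (rybczynski E Good2 Labor)"
      unfolding resp_sgn using labor_border_response_num ews_Labor_Land_pos[OF S] by blast+
    have extreme: "sgn (rybczynski E Good1 Land) = 1" "sgn (rybczynski E Good2 Land) = -1"
      "sgn (rybczynski E Good1 Capital) = -1" "sgn (rybczynski E Good2 Capital) = 1"
      unfolding resp_sgn
      using response_num_Land[OF assms(5-7) opp] response_num_Capital[OF assms(5-7) opp]
      by (simp_all only: sgn_pos sgn_neg)
    \<comment> \<open>Excludes a labor column without a positive entry, so a negative labor entry in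
      one row forces a positive one in the other, and a single border inequality characterizes each
      of the two outer patterns.\<close>
    have labor_sum: "sgn (rybczynski E Good1 Labor) = 1 \<or> sgn (rybczynski E Good2 Labor) = 1"
      unfolding resp_sgn sgn_1_pos
      using response_num_sum[of Labor] response_det_pos[OF assms(5-7)] by linarith
    have border_less: "labor_border E Good2 (ews_ratio_vector E) < 0 \<longleftrightarrow> sgn (rybczynski E Good1 Labor) = -1"
      "labor_border E Good2 (ews_ratio_vector E) > 0 \<longleftrightarrow> sgn (rybczynski E Good1 Labor) = 1"
      "labor_border E Good1 (ews_ratio_vector E) < 0 \<longleftrightarrow> sgn (rybczynski E Good2 Labor) = 1"
      "labor_border E Good1 (ews_ratio_vector E) > 0 \<longleftrightarrow> sgn (rybczynski E Good2 Labor) = -1"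
      unfolding sgn_1_pos[symmetric] sgn_1_neg[symmetric] border by auto
    have sgn_cases: "sgn (rybczynski E j Labor) = 1 \<or> sgn (rybczynski E j Labor) = -1"
      if "rybczynski E j Labor \<noteq> 0" for j
      using that by (auto simp: sgn_if)
    have pattern: "rybczynski_signs E = [[1, -1, x], [-1, 1, y]] \<longleftrightarrow>
        sgn (rybczynski E Good1 Labor) = x \<and> sgn (rybczynski E Good2 Labor) = y" for x y
      by (simp add: rybczynski_signs_def extreme)
    have A: "0 < - reward_gap c Land Labor / reward_gap c Capital Labor"
      "0 > income_share E Labor / income_share E Capital
         * (- reward_gap c Labor Land / reward_gap c Capital Land)"
      using point_A_quadrant_IV[OF S] by (simp_all add: quadrant_IV_def point_A_def)
    have segment: "closed_segment (point_A E c) (point_B E c) \<subseteq> quadrant_IV"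
      using point_A_quadrant_IV[OF S] point_B_quadrant_IV[OF S]
      by (intro closed_segment_subset quadrant_IV_convex)
    show ?Q
      unfolding pattern border_less strong_rybczynski_signs insert_iff
      using A segment point_A_quadrant_IV[OF S] point_B_quadrant_IV[OF S]
        ews_Labor_Land_nonzero[OF S] ews_ratio_vector_in_segment[OF S]
        ews_ratio_vector_quadrant_IV[OF S] land_capital_complements[OF S]
        point_A_left_of_point_B[OF S(1-3)] between[unfolded point_A_def point_B_def fst_conv snd_conv]
        extreme labor_sum sgn_cases[of Good1] sgn_cases[of Good2]
      by (intro conjI impI) (auto 0 0)
  qed (use line in blast)+
qed

end
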